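(* Let $L:\mathcal{B}\to\mathcal{A}$ be left adjoint to $R:\mathcal{A}\to\mathcal{B}$, with unit $\eta$ and counit $\epsilon$. (1) The functor $L$ is h-separable if and only if the forgetful functor $U:{}_{RL}\mathcal{B}\to\mathcal{B}$ is a split epimorphism, i.e. there is a functor $\Gamma:\mathcal{B}\to{}_{RL}\mathcal{B}$ such that $U\circ\Gamma=\mathrm{Id}_{\mathcal{B}}$. (2) The functor $R$ is h-separable if and only if the forgetful functor $U:\mathcal{A}^{LR}\to\mathcal{A}$ is a split epimorphism, i.e. there is a functor $\Gamma:\mathcal{A}\to\mathcal{A}^{LR}$ such that $U\circ\Gamma=\mathrm{Id}_{\mathcal{A}}$.
   Context: A functor $F:\mathcal{B}\to\mathcal{A}$ is h-separable (heavily separable) if there are maps $P_{X,Y}:\mathrm{Hom}_{\mathcal{A}}(FX,FY)\to\mathrm{Hom}_{\mathcal{B}}(X,Y)$, natural in $X,Y\in\mathcal{B}$, such that $P_{X,Y}(Ff)=f$ for every $f:X\to Y$ in $\mathcal{B}$, and $P_{X,Z}(f\circ g)=P_{Y,Z}(f)\circ P_{X,Y}(g)$ for all $X,Y,Z\in\mathcal{B}$ and all $g:FX\to FY$, $f:FY\to FZ$ in $\mathcal{A}$. ${}_{RL}\mathcal{B}$ is the Eilenberg-Moore category (of algebras) of the monad $(RL,R\epsilon L,\eta)$ on $\mathcal{B}$, and $\mathcal{A}^{LR}$ is the Eilenberg-Moore category (of coalgebras) of the comonad $(LR,L\eta R,\epsilon)$ on $\mathcal{A}$. Equalities of functors are strict.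 *)

theory Defs
  imports Main
begin

section \<open>Categories, functors, natural transformations\<close>

text \<open>
  Objects and arrows form subsets of arbitrary types, so no smallness beyond what the
  (universally quantified) types allow is imposed. The operations are unspecified outside
  these carriers.
\<close>

record ('o, 'm) cat =
  Obj :: "'o set"
  Arr :: "'m set"
  Dom :: "'m \<Rightarrow> 'o"
  Cod :: "'m \<Rightarrow> 'o"
  Ident :: "'o \<Rightarrow> 'm"
  Comp :: "'m \<Rightarrow> 'm \<Rightarrow> 'm"  (infixl "\<odot>\<index>" 70)

definition Hom :: "('o, 'm) cat \<Rightarrow> 'o \<Rightarrow> 'o \<Rightarrow> 'm set" where
  "Hom C X Y = {f \<in> Arr C. Dom C f = X \<and> Cod C f = Y}"

locale category =
  fixes C :: "('o, 'm) cat"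
  assumes Dom_in: "f \<in> Arr C \<Longrightarrow> Dom C f \<in> Obj C"
    and Cod_in: "f \<in> Arr C \<Longrightarrow> Cod C f \<in> Obj C"
    and Ident_in: "X \<in> Obj C \<Longrightarrow> Ident C X \<in> Hom C X X"
    and Comp_in: "\<lbrakk>f \<in> Hom C X Y; g \<in> Hom C Y Z\<rbrakk> \<Longrightarrow> g \<odot>\<^bsub>C\<^esub> f \<in> Hom C X Z"
    and Comp_Ident: "f \<in> Hom C X Y \<Longrightarrow> f \<odot>\<^bsub>C\<^esub> Ident C X = f"
    and Ident_Comp: "f \<in> Hom C X Y \<Longrightarrow> Ident C Y \<odot>\<^bsub>C\<^esub> f = f"
    and Comp_assoc: "\<lbrakk>f \<in> Hom C X Y; g \<in> Hom C Y Z; h \<in> Hom C Z W\<rbrakk>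
      \<Longrightarrow> h \<odot>\<^bsub>C\<^esub> g \<odot>\<^bsub>C\<^esub> f = h \<odot>\<^bsub>C\<^esub> (g \<odot>\<^bsub>C\<^esub> f)"

record ('o, 'm, 'p, 'n) fctr =
  fobj :: "'o \<Rightarrow> 'p"
  farr :: "'m \<Rightarrow> 'n"

locale is_functor = source: category C + target: category D
  for C :: "('o, 'm) cat" and D :: "('p, 'n) cat" +
  fixes F :: "('o, 'm, 'p, 'n) fctr"
  assumes fobj_in: "X \<in> Obj C \<Longrightarrow> fobj F X \<in> Obj D"
    and farr_in: "f \<in> Hom C X Y \<Longrightarrow> farr F f \<in> Hom D (fobj F X) (fobj F Y)"
    and farr_Ident: "X \<in> Obj C \<Longrightarrow> farr F (Ident C X) = Ident D (fobj F X)"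
    and farr_Comp: "\<lbrakk>f \<in> Hom C X Y; g \<in> Hom C Y Z\<rbrakk>
      \<Longrightarrow> farr F (g \<odot>\<^bsub>C\<^esub> f) = farr F g \<odot>\<^bsub>D\<^esub> farr F f"

definition id_functor :: "('o, 'm, 'o, 'm) fctr" where
  "id_functor = \<lparr>fobj = (\<lambda>X. X), farr = (\<lambda>f. f)\<rparr>"

definition comp_functor ::
    "('p, 'n, 'q, 'k) fctr \<Rightarrow> ('o, 'm, 'p, 'n) fctr \<Rightarrow> ('o, 'm, 'q, 'k) fctr"
    (infixl "\<circ>\<^sub>F" 70) where
  "G \<circ>\<^sub>F F = \<lparr>fobj = (\<lambda>X. fobj G (fobj F X)), farr = (\<lambda>f. farr G (farr F f))\<rparr>"

text \<open>
  Strict equality of functors with source \<open>C\<close>; the values outside the carriers of \<open>C\<close> are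
  junk and hence disregarded.
\<close>

definition functor_eq ::
    "('o, 'm) cat \<Rightarrow> ('o, 'm, 'p, 'n) fctr \<Rightarrow> ('o, 'm, 'p, 'n) fctr \<Rightarrow> bool" where
  "functor_eq C F G \<longleftrightarrow>
    (\<forall>X\<in>Obj C. fobj F X = fobj G X) \<and> (\<forall>f\<in>Arr C. farr F f = farr G f)"

locale nat_trans = F: is_functor C D F + G: is_functor C D G
  for C :: "('o, 'm) cat" and D :: "('p, 'n) cat"
    and F :: "('o, 'm, 'p, 'n) fctr" and G :: "('o, 'm, 'p, 'n) fctr" +
  fixes \<tau> :: "'o \<Rightarrow> 'n"
  assumes component_in: "X \<in> Obj C \<Longrightarrow> \<tau> X \<in> Hom D (fobj F X) (fobj G X)"
    and naturality: "f \<in> Hom C X Y \<Longrightarrow> \<tau> Y \<odot>\<^bsub>D\<^esub> farr F f = farr G f \<odot>\<^bsub>D\<^esub> \<tau> X"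


section \<open>Adjunctions, monads, comonads\<close>

locale adjunction =
  L: is_functor B A L + R: is_functor A B R +
  unit: nat_trans B B id_functor "R \<circ>\<^sub>F L" \<eta> +
  counit: nat_trans A A "L \<circ>\<^sub>F R" id_functor \<epsilon>
  for B :: "('ob, 'mb) cat" and A :: "('oa, 'ma) cat"
    and L :: "('ob, 'mb, 'oa, 'ma) fctr" and R :: "('oa, 'ma, 'ob, 'mb) fctr"
    and \<eta> :: "'ob \<Rightarrow> 'mb" and \<epsilon> :: "'oa \<Rightarrow> 'ma" +
  assumes triangle_L:
      "X \<in> Obj B \<Longrightarrow> \<epsilon> (fobj L X) \<odot>\<^bsub>A\<^esub> farr L (\<eta> X) = Ident A (fobj L X)"
    and triangle_R:
      "Y \<in> Obj A \<Longrightarrow> farr R (\<epsilon> Y) \<odot>\<^bsub>B\<^esub> \<eta> (fobj R Y) = Ident B (fobj R Y)"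

locale monad =
  mult: nat_trans C C "T \<circ>\<^sub>F T" T \<mu> + unit: nat_trans C C id_functor T \<eta>
  for C :: "('o, 'm) cat" and T :: "('o, 'm, 'o, 'm) fctr"
    and \<mu> :: "'o \<Rightarrow> 'm" and \<eta> :: "'o \<Rightarrow> 'm" +
  assumes assoc: "X \<in> Obj C \<Longrightarrow> \<mu> X \<odot>\<^bsub>C\<^esub> farr T (\<mu> X) = \<mu> X \<odot>\<^bsub>C\<^esub> \<mu> (fobj T X)"
    and unit_left: "X \<in> Obj C \<Longrightarrow> \<mu> X \<odot>\<^bsub>C\<^esub> \<eta> (fobj T X) = Ident C (fobj T X)"
    and unit_right: "X \<in> Obj C \<Longrightarrow> \<mu> X \<odot>\<^bsub>C\<^esub> farr T (\<eta> X) = Ident C (fobj T X)"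

locale comonad =
  comult: nat_trans C C G "G \<circ>\<^sub>F G" \<delta> + counit: nat_trans C C G id_functor \<epsilon>
  for C :: "('o, 'm) cat" and G :: "('o, 'm, 'o, 'm) fctr"
    and \<delta> :: "'o \<Rightarrow> 'm" and \<epsilon> :: "'o \<Rightarrow> 'm" +
  assumes coassoc: "X \<in> Obj C \<Longrightarrow> farr G (\<delta> X) \<odot>\<^bsub>C\<^esub> \<delta> X = \<delta> (fobj G X) \<odot>\<^bsub>C\<^esub> \<delta> X"
    and counit_left: "X \<in> Obj C \<Longrightarrow> \<epsilon> (fobj G X) \<odot>\<^bsub>C\<^esub> \<delta> X = Ident C (fobj G X)"
    and counit_right: "X \<in> Obj C \<Longrightarrow> farr G (\<epsilon> X) \<odot>\<^bsub>C\<^esub> \<delta> X = Ident C (fobj G X)"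


section \<open>Eilenberg-Moore categories\<close>

definition algebras ::
    "('o, 'm) cat \<Rightarrow> ('o, 'm, 'o, 'm) fctr \<Rightarrow> ('o \<Rightarrow> 'm) \<Rightarrow> ('o \<Rightarrow> 'm) \<Rightarrow> ('o \<times> 'm) set" where
  "algebras C T \<mu> \<eta> = {(X, a). X \<in> Obj C \<and> a \<in> Hom C (fobj T X) X \<and>
     a \<odot>\<^bsub>C\<^esub> \<eta> X = Ident C X \<and> a \<odot>\<^bsub>C\<^esub> \<mu> X = a \<odot>\<^bsub>C\<^esub> farr T a}"

text \<open>
  A morphism of algebras is recorded together with its source and target algebra, since the
  same arrow of \<open>C\<close> may be a morphism between several pairs of algebras.
\<close>

definition EM_algebras ::
    "('o, 'm) cat \<Rightarrow> ('o, 'm, 'o, 'm) fctr \<Rightarrow> ('o \<Rightarrow> 'm) \<Rightarrow> ('o \<Rightarrow> 'm) \<Rightarrow>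
     ('o \<times> 'm, ('o \<times> 'm) \<times> ('o \<times> 'm) \<times> 'm) cat" where
  "EM_algebras C T \<mu> \<eta> =
    \<lparr>Obj = algebras C T \<mu> \<eta>,
     Arr = {((X, a), (Y, b), f) | X a Y b f.
              (X, a) \<in> algebras C T \<mu> \<eta> \<and> (Y, b) \<in> algebras C T \<mu> \<eta> \<and>
              f \<in> Hom C X Y \<and> f \<odot>\<^bsub>C\<^esub> a = b \<odot>\<^bsub>C\<^esub> farr T f},
     Dom = (\<lambda>(S, S', f). S),
     Cod = (\<lambda>(S, S', f). S'),
     Ident = (\<lambda>S. (S, S, Ident C (fst S))),
     Comp = (\<lambda>(S', S'', g) (S, _, f). (S, S'', g \<odot>\<^bsub>C\<^esub> f))\<rparr>"

definition coalgebras ::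
    "('o, 'm) cat \<Rightarrow> ('o, 'm, 'o, 'm) fctr \<Rightarrow> ('o \<Rightarrow> 'm) \<Rightarrow> ('o \<Rightarrow> 'm) \<Rightarrow> ('o \<times> 'm) set" where
  "coalgebras C G \<delta> \<epsilon> = {(X, c). X \<in> Obj C \<and> c \<in> Hom C X (fobj G X) \<and>
     \<epsilon> X \<odot>\<^bsub>C\<^esub> c = Ident C X \<and> \<delta> X \<odot>\<^bsub>C\<^esub> c = farr G c \<odot>\<^bsub>C\<^esub> c}"

definition EM_coalgebras ::
    "('o, 'm) cat \<Rightarrow> ('o, 'm, 'o, 'm) fctr \<Rightarrow> ('o \<Rightarrow> 'm) \<Rightarrow> ('o \<Rightarrow> 'm) \<Rightarrow>
     ('o \<times> 'm, ('o \<times> 'm) \<times> ('o \<times> 'm) \<times> 'm) cat" where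
  "EM_coalgebras C G \<delta> \<epsilon> =
    \<lparr>Obj = coalgebras C G \<delta> \<epsilon>,
     Arr = {((X, c), (Y, d), f) | X c Y d f.
              (X, c) \<in> coalgebras C G \<delta> \<epsilon> \<and> (Y, d) \<in> coalgebras C G \<delta> \<epsilon> \<and>
              f \<in> Hom C X Y \<and> d \<odot>\<^bsub>C\<^esub> f = farr G f \<odot>\<^bsub>C\<^esub> c},
     Dom = (\<lambda>(S, S', f). S),
     Cod = (\<lambda>(S, S', f). S'),
     Ident = (\<lambda>S. (S, S, Ident C (fst S))),
     Comp = (\<lambda>(S', S'', g) (S, _, f). (S, S'', g \<odot>\<^bsub>C\<^esub> f))\<rparr>"

text \<open>The forgetful functor has the same underlying maps for algebras and for coalgebras.\<close>

definition forgetful :: "('o \<times> 'm, ('o \<times> 'm) \<times> ('o \<times> 'm) \<times> 'm, 'o, 'm) fctr" where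
  "forgetful = \<lparr>fobj = (\<lambda>(X, a). X), farr = (\<lambda>(S, S', f). f)\<rparr>"


section \<open>Heavy separability and split epimorphisms\<close>

definition h_separable ::
    "('ob, 'mb) cat \<Rightarrow> ('oa, 'ma) cat \<Rightarrow> ('ob, 'mb, 'oa, 'ma) fctr \<Rightarrow> bool" where
  "h_separable B A F \<longleftrightarrow> (\<exists>P :: 'ob \<Rightarrow> 'ob \<Rightarrow> 'ma \<Rightarrow> 'mb.
     (\<forall>X\<in>Obj B. \<forall>Y\<in>Obj B. \<forall>h\<in>Hom A (fobj F X) (fobj F Y). P X Y h \<in> Hom B X Y) \<and>
     (\<forall>X\<in>Obj B. \<forall>Y\<in>Obj B. \<forall>X'\<in>Obj B. \<forall>Y'\<in>Obj B.
        \<forall>u\<in>Hom B X' X. \<forall>v\<in>Hom B Y Y'. \<forall>h\<in>Hom A (fobj F X) (fobj F Y).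
          P X' Y' (farr F v \<odot>\<^bsub>A\<^esub> h \<odot>\<^bsub>A\<^esub> farr F u) = v \<odot>\<^bsub>B\<^esub> P X Y h \<odot>\<^bsub>B\<^esub> u) \<and>
     (\<forall>X\<in>Obj B. \<forall>Y\<in>Obj B. \<forall>f\<in>Hom B X Y. P X Y (farr F f) = f) \<and>
     (\<forall>X\<in>Obj B. \<forall>Y\<in>Obj B. \<forall>Z\<in>Obj B.
        \<forall>g\<in>Hom A (fobj F X) (fobj F Y). \<forall>f\<in>Hom A (fobj F Y) (fobj F Z).
          P X Z (f \<odot>\<^bsub>A\<^esub> g) = P Y Z f \<odot>\<^bsub>B\<^esub> P X Y g))"

definition split_epi_functor ::
    "('p, 'n) cat \<Rightarrow> ('o, 'm) cat \<Rightarrow> ('p, 'n, 'o, 'm) fctr \<Rightarrow> bool" where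
  "split_epi_functor D C U \<longleftrightarrow>
    (\<exists>\<Gamma> :: ('o, 'm, 'p, 'n) fctr. is_functor C D \<Gamma> \<and> functor_eq C (U \<circ>\<^sub>F \<Gamma>) id_functor)"


section \<open>The (co)monad of an adjunction and well-definedness of the Eilenberg-Moore categories\<close>

lemma comp_functor_simps [simp]:
  "fobj (G \<circ>\<^sub>F F) X = fobj G (fobj F X)" "farr (G \<circ>\<^sub>F F) f = farr G (farr F f)"
  "fobj id_functor X' = X'" "farr id_functor f' = f'"
  by (simp_all add: comp_functor_def id_functor_def)

lemma is_functor_comp:
  assumes "is_functor C D F" "is_functor D E G"
  shows "is_functor C E (G \<circ>\<^sub>F F)"
proof -
  interpret F: is_functor C D F by fact
  interpret G: is_functor D E G by fact
  show ?thesis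
  proof unfold_locales
    fix f g X Y Z assume fg: "f \<in> Hom C X Y" "g \<in> Hom C Y Z"
    show "farr (G \<circ>\<^sub>F F) (g \<odot>\<^bsub>C\<^esub> f) = farr (G \<circ>\<^sub>F F) g \<odot>\<^bsub>E\<^esub> farr (G \<circ>\<^sub>F F) f"
      using F.farr_Comp[OF fg] G.farr_Comp[OF F.farr_in[OF fg(1)] F.farr_in[OF fg(2)]] by simp
  qed (simp_all add: F.farr_Ident[simplified] G.farr_Ident F.fobj_in G.fobj_in F.farr_in G.farr_in)
qed

context adjunction
begin

lemma monad_RL: "monad B (R \<circ>\<^sub>F L) (\<lambda>X. farr R (\<epsilon> (fobj L X))) \<eta>"
proof -
  have T: "is_functor B B (R \<circ>\<^sub>F L)"
    using is_functor_comp L.is_functor_axioms R.is_functor_axioms .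
  have e: "\<epsilon> Y \<in> Hom A (fobj L (fobj R Y)) Y" if "Y \<in> Obj A" for Y
    using counit.component_in[OF that] by simp
  have n: "\<eta> X \<in> Hom B X (fobj R (fobj L X))" if "X \<in> Obj B" for X
    using unit.component_in[OF that] by simp
  have nat: "\<epsilon> Y \<odot>\<^bsub>A\<^esub> farr L (farr R f) = f \<odot>\<^bsub>A\<^esub> \<epsilon> X" if "f \<in> Hom A X Y" for f X Y
    using counit.naturality[OF that] by simp
  have sq: "farr R (\<epsilon> Y) \<odot>\<^bsub>B\<^esub> farr R (farr L (farr R f)) = farr R f \<odot>\<^bsub>B\<^esub> farr R (\<epsilon> X)"
    if f: "f \<in> Hom A X Y" and X: "X \<in> Obj A" and Y: "Y \<in> Obj A" for f X Y
    using arg_cong[OF nat[OF f], of "farr R"]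
      R.farr_Comp[OF L.farr_in[OF R.farr_in[OF f]] e[OF Y]] R.farr_Comp[OF e[OF X] f]
    by simp
  have ob: "X \<in> Obj B \<and> Y \<in> Obj B" if "f \<in> Hom B X Y" for f X Y
    using that L.source.Dom_in L.source.Cod_in by (auto simp: Hom_def)
  show ?thesis
    unfolding monad_def monad_axioms_def nat_trans_def nat_trans_axioms_def
  proof (intro conjI allI impI)
    show "is_functor B B (R \<circ>\<^sub>F L \<circ>\<^sub>F (R \<circ>\<^sub>F L))" using is_functor_comp T T .
  next
    fix X assume X: "X \<in> Obj B"
    show "farr R (\<epsilon> (fobj L X)) \<in> Hom B (fobj (R \<circ>\<^sub>F L \<circ>\<^sub>F (R \<circ>\<^sub>F L)) X) (fobj (R \<circ>\<^sub>F L) X)"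
      using R.farr_in[OF e[OF L.fobj_in[OF X]]] by simp
    show "\<eta> X \<in> Hom B (fobj id_functor X) (fobj (R \<circ>\<^sub>F L) X)" using n[OF X] by simp
    show "farr R (\<epsilon> (fobj L X)) \<odot>\<^bsub>B\<^esub> farr (R \<circ>\<^sub>F L) (farr R (\<epsilon> (fobj L X))) =
      farr R (\<epsilon> (fobj L X)) \<odot>\<^bsub>B\<^esub> farr R (\<epsilon> (fobj L (fobj (R \<circ>\<^sub>F L) X)))"
      using sq[OF e] X by (simp add: L.fobj_in R.fobj_in)
    show "farr R (\<epsilon> (fobj L X)) \<odot>\<^bsub>B\<^esub> \<eta> (fobj (R \<circ>\<^sub>F L) X) = Ident B (fobj (R \<circ>\<^sub>F L) X)"
      using triangle_R[OF L.fobj_in[OF X]] by simp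
    show "farr R (\<epsilon> (fobj L X)) \<odot>\<^bsub>B\<^esub> farr (R \<circ>\<^sub>F L) (\<eta> X) = Ident B (fobj (R \<circ>\<^sub>F L) X)"
      using triangle_L[OF X] R.farr_Comp[OF L.farr_in[OF n[OF X]] e[OF L.fobj_in[OF X]]]
        R.farr_Ident[OF L.fobj_in[OF X]] by simp
  next
    fix f X Y assume f: "f \<in> Hom B X Y"
    show "farr R (\<epsilon> (fobj L Y)) \<odot>\<^bsub>B\<^esub> farr (R \<circ>\<^sub>F L \<circ>\<^sub>F (R \<circ>\<^sub>F L)) f =
      farr (R \<circ>\<^sub>F L) f \<odot>\<^bsub>B\<^esub> farr R (\<epsilon> (fobj L X))"
      using sq[OF L.farr_in[OF f]] ob[OF f] L.fobj_in by simp
    show "\<eta> Y \<odot>\<^bsub>B\<^esub> farr id_functor f = farr (R \<circ>\<^sub>F L) f \<odot>\<^bsub>B\<^esub> \<eta> X"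
      using unit.naturality[OF f] by simp
  qed (use T unit.nat_trans_axioms in \<open>auto simp: nat_trans_def\<close>)
qed

lemma comonad_LR: "comonad A (L \<circ>\<^sub>F R) (\<lambda>Y. farr L (\<eta> (fobj R Y))) \<epsilon>"
proof -
  have T: "is_functor A A (L \<circ>\<^sub>F R)"
    using is_functor_comp R.is_functor_axioms L.is_functor_axioms .
  have e: "\<epsilon> Y \<in> Hom A (fobj L (fobj R Y)) Y" if "Y \<in> Obj A" for Y
    using counit.component_in[OF that] by simp
  have n: "\<eta> X \<in> Hom B X (fobj R (fobj L X))" if "X \<in> Obj B" for X
    using unit.component_in[OF that] by simp
  have nat: "\<eta> Y \<odot>\<^bsub>B\<^esub> f = farr R (farr L f) \<odot>\<^bsub>B\<^esub> \<eta> X" if "f \<in> Hom B X Y" for f X Y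
    using unit.naturality[OF that] by simp
  have sq: "farr L (\<eta> Y) \<odot>\<^bsub>A\<^esub> farr L f = farr L (farr R (farr L f)) \<odot>\<^bsub>A\<^esub> farr L (\<eta> X)"
    if f: "f \<in> Hom B X Y" and X: "X \<in> Obj B" and Y: "Y \<in> Obj B" for f X Y
    using arg_cong[OF nat[OF f], of "farr L"]
      L.farr_Comp[OF f n[OF Y]] L.farr_Comp[OF n[OF X] R.farr_in[OF L.farr_in[OF f]]]
    by simp
  have ob: "X \<in> Obj A \<and> Y \<in> Obj A" if "f \<in> Hom A X Y" for f X Y
    using that L.target.Dom_in L.target.Cod_in by (auto simp: Hom_def)
  show ?thesis
    unfolding comonad_def comonad_axioms_def nat_trans_def nat_trans_axioms_def
  proof (intro conjI allI impI)
    show "is_functor A A (L \<circ>\<^sub>F R \<circ>\<^sub>F (L \<circ>\<^sub>F R))" using is_functor_comp T T .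
  next
    fix X assume X: "X \<in> Obj A"
    show "farr L (\<eta> (fobj R X)) \<in> Hom A (fobj (L \<circ>\<^sub>F R) X) (fobj (L \<circ>\<^sub>F R \<circ>\<^sub>F (L \<circ>\<^sub>F R)) X)"
      using L.farr_in[OF n[OF R.fobj_in[OF X]]] by simp
    show "\<epsilon> X \<in> Hom A (fobj (L \<circ>\<^sub>F R) X) (fobj id_functor X)" using e[OF X] by simp
    show "farr (L \<circ>\<^sub>F R) (farr L (\<eta> (fobj R X))) \<odot>\<^bsub>A\<^esub> farr L (\<eta> (fobj R X)) =
      farr L (\<eta> (fobj R (fobj (L \<circ>\<^sub>F R) X))) \<odot>\<^bsub>A\<^esub> farr L (\<eta> (fobj R X))"
      using sq[OF n] X by (simp add: L.fobj_in R.fobj_in)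
    show "\<epsilon> (fobj (L \<circ>\<^sub>F R) X) \<odot>\<^bsub>A\<^esub> farr L (\<eta> (fobj R X)) = Ident A (fobj (L \<circ>\<^sub>F R) X)"
      using triangle_L[OF R.fobj_in[OF X]] by simp
    show "farr (L \<circ>\<^sub>F R) (\<epsilon> X) \<odot>\<^bsub>A\<^esub> farr L (\<eta> (fobj R X)) = Ident A (fobj (L \<circ>\<^sub>F R) X)"
      using triangle_R[OF X] L.farr_Comp[OF n[OF R.fobj_in[OF X]] R.farr_in[OF e[OF X]]]
        L.farr_Ident[OF R.fobj_in[OF X]] by simp
  next
    fix f X Y assume f: "f \<in> Hom A X Y"
    show "farr L (\<eta> (fobj R Y)) \<odot>\<^bsub>A\<^esub> farr (L \<circ>\<^sub>F R) f =
      farr (L \<circ>\<^sub>F R \<circ>\<^sub>F (L \<circ>\<^sub>F R)) f \<odot>\<^bsub>A\<^esub> farr L (\<eta> (fobj R X))"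
      using sq[OF R.farr_in[OF f]] ob[OF f] R.fobj_in by simp
    show "\<epsilon> Y \<odot>\<^bsub>A\<^esub> farr (L \<circ>\<^sub>F R) f = farr id_functor f \<odot>\<^bsub>A\<^esub> \<epsilon> X"
      using counit.naturality[OF f] by simp
  qed (use T counit.nat_trans_axioms in \<open>auto simp: nat_trans_def\<close>)
qed

end

lemma EM_algebras_simps:
  "Obj (EM_algebras C T \<mu> \<eta>) = algebras C T \<mu> \<eta>"
  "Dom (EM_algebras C T \<mu> \<eta>) (S, S', f) = S"
  "Cod (EM_algebras C T \<mu> \<eta>) (S, S', f) = S'"
  "Ident (EM_algebras C T \<mu> \<eta>) S = (S, S, Ident C (fst S))"
  "(S', S'', g) \<odot>\<^bsub>EM_algebras C T \<mu> \<eta>\<^esub> (S, S3, f) = (S, S'', g \<odot>\<^bsub>C\<^esub> f)"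
  "(S, S', f) \<in> Arr (EM_algebras C T \<mu> \<eta>) \<longleftrightarrow> S \<in> algebras C T \<mu> \<eta> \<and> S' \<in> algebras C T \<mu> \<eta> \<and>
     f \<in> Hom C (fst S) (fst S') \<and> f \<odot>\<^bsub>C\<^esub> snd S = snd S' \<odot>\<^bsub>C\<^esub> farr T f"
  by (cases S; cases S'; auto simp: EM_algebras_def)+

lemma Hom_EM_algebras:
  "h \<in> Hom (EM_algebras C T \<mu> \<eta>) S S' \<longleftrightarrow> (\<exists>f. h = (S, S', f) \<and>
     S \<in> algebras C T \<mu> \<eta> \<and> S' \<in> algebras C T \<mu> \<eta> \<and>
     f \<in> Hom C (fst S) (fst S') \<and> f \<odot>\<^bsub>C\<^esub> snd S = snd S' \<odot>\<^bsub>C\<^esub> farr T f)"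
  by (cases h) (auto simp: Hom_def[of "EM_algebras C T \<mu> \<eta>"] EM_algebras_simps)

lemma category_EM_algebras:
  assumes "monad C T \<mu> \<eta>"
  shows "category (EM_algebras C T \<mu> \<eta>)" (is "category ?E")
proof -
  interpret T: is_functor C C T using assms by (simp add: monad_def nat_trans_def)
  have st: "snd S \<in> Hom C (fobj T (fst S)) (fst S)" "fst S \<in> Obj C"
    if "S \<in> algebras C T \<mu> \<eta>" for S
    using that by (auto simp: algebras_def)
  show ?thesis
  proof
    fix h assume h: "h \<in> Arr ?E"
    show "Dom ?E h \<in> Obj ?E" "Cod ?E h \<in> Obj ?E"
      using h by (cases h; simp add: EM_algebras_simps)+
  next
    fix S assume S: "S \<in> Obj ?E"
    then show "Ident ?E S \<in> Hom ?E S S"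
      using st[of S] T.source.Ident_in[of "fst S"] T.farr_Ident[of "fst S"]
        T.source.Comp_Ident[of "snd S"] T.source.Ident_Comp[of "snd S"]
      by (simp add: EM_algebras_simps Hom_EM_algebras)
  next
    fix h k S S' S''
    assume hk: "h \<in> Hom ?E S S'" "k \<in> Hom ?E S' S''"
    obtain f where h: "h = (S, S', f)" and f: "f \<in> Hom C (fst S) (fst S')"
      "f \<odot>\<^bsub>C\<^esub> snd S = snd S' \<odot>\<^bsub>C\<^esub> farr T f"
      using hk(1) unfolding Hom_EM_algebras by blast
    obtain g where k: "k = (S', S'', g)" and g: "g \<in> Hom C (fst S') (fst S'')"
      "g \<odot>\<^bsub>C\<^esub> snd S' = snd S'' \<odot>\<^bsub>C\<^esub> farr T g"
      using hk(2) unfolding Hom_EM_algebras by blast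
    have S: "S \<in> algebras C T \<mu> \<eta>" "S' \<in> algebras C T \<mu> \<eta>" "S'' \<in> algebras C T \<mu> \<eta>"
      using hk unfolding Hom_EM_algebras by blast+
    note st = st(1)[OF S(1)] st(1)[OF S(2)] st(1)[OF S(3)]
    have "g \<odot>\<^bsub>C\<^esub> f \<odot>\<^bsub>C\<^esub> snd S = snd S'' \<odot>\<^bsub>C\<^esub> farr T (g \<odot>\<^bsub>C\<^esub> f)"
    proof -
      have "g \<odot>\<^bsub>C\<^esub> f \<odot>\<^bsub>C\<^esub> snd S = g \<odot>\<^bsub>C\<^esub> (snd S' \<odot>\<^bsub>C\<^esub> farr T f)"
        using T.source.Comp_assoc[OF st(1) f(1) g(1)] f(2) by simp
      also have "\<dots> = snd S'' \<odot>\<^bsub>C\<^esub> farr T g \<odot>\<^bsub>C\<^esub> farr T f"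
        using T.source.Comp_assoc[OF T.farr_in[OF f(1)] st(2) g(1)] g(2) by simp
      also have "\<dots> = snd S'' \<odot>\<^bsub>C\<^esub> farr T (g \<odot>\<^bsub>C\<^esub> f)"
        using T.source.Comp_assoc[OF T.farr_in[OF f(1)] T.farr_in[OF g(1)] st(3)]
          T.farr_Comp[OF f(1) g(1)] by simp
      finally show ?thesis .
    qed
    then show "k \<odot>\<^bsub>?E\<^esub> h \<in> Hom ?E S S''"
      using S T.source.Comp_in[OF f(1) g(1)] by (simp add: h k EM_algebras_simps Hom_EM_algebras)
  next
    fix h S S' assume "h \<in> Hom ?E S S'"
    then show "h \<odot>\<^bsub>?E\<^esub> Ident ?E S = h" "Ident ?E S' \<odot>\<^bsub>?E\<^esub> h = h"
      unfolding Hom_EM_algebras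
      by (auto simp: EM_algebras_simps T.source.Comp_Ident T.source.Ident_Comp)
  next
    fix h k l S S' S'' S3
    assume "h \<in> Hom ?E S S'" "k \<in> Hom ?E S' S''" "l \<in> Hom ?E S'' S3"
    then show "l \<odot>\<^bsub>?E\<^esub> k \<odot>\<^bsub>?E\<^esub> h = l \<odot>\<^bsub>?E\<^esub> (k \<odot>\<^bsub>?E\<^esub> h)"
      unfolding Hom_EM_algebras by (auto simp: EM_algebras_simps intro: T.source.Comp_assoc)
  qed
qed

lemma is_functor_forgetful_algebras:
  assumes "monad C T \<mu> \<eta>"
  shows "is_functor (EM_algebras C T \<mu> \<eta>) C forgetful"
  unfolding is_functor_def is_functor_axioms_def
  using category_EM_algebras[OF assms] assms
  by (auto simp: monad_def nat_trans_def is_functor_def Hom_EM_algebras EM_algebras_simps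
      forgetful_def algebras_def)

lemma EM_coalgebras_simps:
  "Obj (EM_coalgebras C G \<delta> \<epsilon>) = coalgebras C G \<delta> \<epsilon>"
  "Dom (EM_coalgebras C G \<delta> \<epsilon>) (S, S', f) = S"
  "Cod (EM_coalgebras C G \<delta> \<epsilon>) (S, S', f) = S'"
  "Ident (EM_coalgebras C G \<delta> \<epsilon>) S = (S, S, Ident C (fst S))"
  "(S', S'', g) \<odot>\<^bsub>EM_coalgebras C G \<delta> \<epsilon>\<^esub> (S, S3, f) = (S, S'', g \<odot>\<^bsub>C\<^esub> f)"
  "(S, S', f) \<in> Arr (EM_coalgebras C G \<delta> \<epsilon>) \<longleftrightarrow> S \<in> coalgebras C G \<delta> \<epsilon> \<and> S' \<in> coalgebras C G \<delta> \<epsilon> \<and>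
     f \<in> Hom C (fst S) (fst S') \<and> snd S' \<odot>\<^bsub>C\<^esub> f = farr G f \<odot>\<^bsub>C\<^esub> snd S"
  by (cases S; cases S'; auto simp: EM_coalgebras_def)+

lemma Hom_EM_coalgebras:
  "h \<in> Hom (EM_coalgebras C G \<delta> \<epsilon>) S S' \<longleftrightarrow> (\<exists>f. h = (S, S', f) \<and>
     S \<in> coalgebras C G \<delta> \<epsilon> \<and> S' \<in> coalgebras C G \<delta> \<epsilon> \<and>
     f \<in> Hom C (fst S) (fst S') \<and> snd S' \<odot>\<^bsub>C\<^esub> f = farr G f \<odot>\<^bsub>C\<^esub> snd S)"
  by (cases h) (auto simp: Hom_def[of "EM_coalgebras C G \<delta> \<epsilon>"] EM_coalgebras_simps)

lemma category_EM_coalgebras: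
  assumes "comonad C G \<delta> \<epsilon>"
  shows "category (EM_coalgebras C G \<delta> \<epsilon>)" (is "category ?E")
proof -
  interpret G: is_functor C C G using assms by (simp add: comonad_def nat_trans_def)
  have st: "snd S \<in> Hom C (fst S) (fobj G (fst S))" "fst S \<in> Obj C"
    if "S \<in> coalgebras C G \<delta> \<epsilon>" for S
    using that by (auto simp: coalgebras_def)
  show ?thesis
  proof
    fix h assume h: "h \<in> Arr ?E"
    show "Dom ?E h \<in> Obj ?E" "Cod ?E h \<in> Obj ?E"
      using h by (cases h; simp add: EM_coalgebras_simps)+
  next
    fix S assume S: "S \<in> Obj ?E"
    then show "Ident ?E S \<in> Hom ?E S S"
      using st[of S] G.source.Ident_in[of "fst S"] G.farr_Ident[of "fst S"]
        G.source.Comp_Ident[of "snd S"] G.source.Ident_Comp[of "snd S"]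
      by (simp add: EM_coalgebras_simps Hom_EM_coalgebras)
  next
    fix h k S S' S''
    assume hk: "h \<in> Hom ?E S S'" "k \<in> Hom ?E S' S''"
    obtain f where h: "h = (S, S', f)" and f: "f \<in> Hom C (fst S) (fst S')"
      "snd S' \<odot>\<^bsub>C\<^esub> f = farr G f \<odot>\<^bsub>C\<^esub> snd S"
      using hk(1) unfolding Hom_EM_coalgebras by blast
    obtain g where k: "k = (S', S'', g)" and g: "g \<in> Hom C (fst S') (fst S'')"
      "snd S'' \<odot>\<^bsub>C\<^esub> g = farr G g \<odot>\<^bsub>C\<^esub> snd S'"
      using hk(2) unfolding Hom_EM_coalgebras by blast
    have S: "S \<in> coalgebras C G \<delta> \<epsilon>" "S' \<in> coalgebras C G \<delta> \<epsilon>" "S'' \<in> coalgebras C G \<delta> \<epsilon>"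
      using hk unfolding Hom_EM_coalgebras by blast+
    note st = st(1)[OF S(1)] st(1)[OF S(2)] st(1)[OF S(3)]
    have "snd S'' \<odot>\<^bsub>C\<^esub> (g \<odot>\<^bsub>C\<^esub> f) = farr G (g \<odot>\<^bsub>C\<^esub> f) \<odot>\<^bsub>C\<^esub> snd S"
    proof -
      have "snd S'' \<odot>\<^bsub>C\<^esub> (g \<odot>\<^bsub>C\<^esub> f) = farr G g \<odot>\<^bsub>C\<^esub> snd S' \<odot>\<^bsub>C\<^esub> f"
        using G.source.Comp_assoc[OF f(1) g(1) st(3)] g(2) by simp
      also have "\<dots> = farr G g \<odot>\<^bsub>C\<^esub> (farr G f \<odot>\<^bsub>C\<^esub> snd S)"
        using G.source.Comp_assoc[OF f(1) st(2) G.farr_in[OF g(1)]] f(2) by simp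
      also have "\<dots> = farr G (g \<odot>\<^bsub>C\<^esub> f) \<odot>\<^bsub>C\<^esub> snd S"
        using G.source.Comp_assoc[OF st(1) G.farr_in[OF f(1)] G.farr_in[OF g(1)]]
          G.farr_Comp[OF f(1) g(1)] by simp
      finally show ?thesis .
    qed
    then show "k \<odot>\<^bsub>?E\<^esub> h \<in> Hom ?E S S''"
      using S G.source.Comp_in[OF f(1) g(1)] by (simp add: h k EM_coalgebras_simps Hom_EM_coalgebras)
  next
    fix h S S' assume "h \<in> Hom ?E S S'"
    then show "h \<odot>\<^bsub>?E\<^esub> Ident ?E S = h" "Ident ?E S' \<odot>\<^bsub>?E\<^esub> h = h"
      unfolding Hom_EM_coalgebras
      by (auto simp: EM_coalgebras_simps G.source.Comp_Ident G.source.Ident_Comp)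
  next
    fix h k l S S' S'' S3
    assume "h \<in> Hom ?E S S'" "k \<in> Hom ?E S' S''" "l \<in> Hom ?E S'' S3"
    then show "l \<odot>\<^bsub>?E\<^esub> k \<odot>\<^bsub>?E\<^esub> h = l \<odot>\<^bsub>?E\<^esub> (k \<odot>\<^bsub>?E\<^esub> h)"
      unfolding Hom_EM_coalgebras by (auto simp: EM_coalgebras_simps intro: G.source.Comp_assoc)
  qed
qed

lemma is_functor_forgetful_coalgebras:
  assumes "comonad C G \<delta> \<epsilon>"
  shows "is_functor (EM_coalgebras C G \<delta> \<epsilon>) C forgetful"
  unfolding is_functor_def is_functor_axioms_def
  using category_EM_coalgebras[OF assms] assms
  by (auto simp: comonad_def nat_trans_def is_functor_def Hom_EM_coalgebras EM_coalgebras_simps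
      forgetful_def coalgebras_def)

end

theory Submission
  imports Defs
begin

text \<open>
  A section \<open>\<Gamma>\<close> of the forgetful functor puts an algebra structure \<open>\<gamma> X : RLX \<rightarrow> X\<close> on every
  object \<open>X\<close> in such a way that every arrow of the base is an algebra morphism; in other words,
  it is a natural retraction \<open>\<gamma>\<close> of the unit with \<open>\<gamma> \<circ> \<mu> = \<gamma> \<circ> RL\<gamma>\<close>
  (\<open>split_epi_forgetful_algebras_iff\<close>). The theorem says that such retractions are the same as
  multiplicative splittings \<open>P\<close> of \<open>L\<close> on arrows, and the two determine each other by
  \<open>\<gamma>\<^sub>X = P(\<epsilon>\<^bsub>LX\<^esub>)\<close> and \<open>P(h) = \<gamma>\<^sub>Y \<circ> Rh \<circ> \<eta>\<^sub>X\<close> for \<open>h : LX \<rightarrow> LY\<close>.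

  In one direction the algebra laws come from applying \<open>P\<close> to the triangle identity and to
  naturality squares of \<open>\<epsilon>\<close>. In the other direction the point is multiplicativity,
  \<open>\<gamma>\<^sub>Z Rf \<eta>\<^sub>Y \<gamma>\<^sub>Y Rg \<eta>\<^sub>X = \<gamma>\<^sub>Z Rf Rg \<eta>\<^sub>X\<close>: the factor \<open>\<eta>\<^sub>Y \<gamma>\<^sub>Y\<close> is not an identity, but it is absorbed
  by \<open>\<gamma>\<^sub>Z Rf\<close>, because \<open>\<gamma>\<^sub>Z \<circ> Rf\<close> is a morphism of algebras from the free algebra on \<open>Y\<close> to
  \<open>(Z, \<gamma>\<^sub>Z)\<close> and so is determined by its restriction along \<open>\<eta>\<^sub>Y\<close>.

  The second equivalence is the first one for the opposite adjunction, in which \<open>R\<close> is the left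
  adjoint and \<open>\<epsilon>\<close> is the unit (\<open>adjunction_op\<close>).
\<close>

section \<open>Sections of the forgetful functors\<close>

definition natural_algebra_structure ::
    "('o, 'm) cat \<Rightarrow> ('o, 'm, 'o, 'm) fctr \<Rightarrow> ('o \<Rightarrow> 'm) \<Rightarrow> ('o \<Rightarrow> 'm) \<Rightarrow> ('o \<Rightarrow> 'm) \<Rightarrow> bool" where
  "natural_algebra_structure C T \<mu> \<eta> \<gamma> \<longleftrightarrow>
    (\<forall>X\<in>Obj C. (X, \<gamma> X) \<in> algebras C T \<mu> \<eta>) \<and>
    (\<forall>X Y. \<forall>f\<in>Hom C X Y. f \<odot>\<^bsub>C\<^esub> \<gamma> X = \<gamma> Y \<odot>\<^bsub>C\<^esub> farr T f)"

definition natural_coalgebra_structure ::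
    "('o, 'm) cat \<Rightarrow> ('o, 'm, 'o, 'm) fctr \<Rightarrow> ('o \<Rightarrow> 'm) \<Rightarrow> ('o \<Rightarrow> 'm) \<Rightarrow> ('o \<Rightarrow> 'm) \<Rightarrow> bool" where
  "natural_coalgebra_structure C G \<delta> \<epsilon> \<gamma> \<longleftrightarrow>
    (\<forall>X\<in>Obj C. (X, \<gamma> X) \<in> coalgebras C G \<delta> \<epsilon>) \<and>
    (\<forall>X Y. \<forall>f\<in>Hom C X Y. \<gamma> Y \<odot>\<^bsub>C\<^esub> f = farr G f \<odot>\<^bsub>C\<^esub> \<gamma> X)"

lemma (in category) Hom_Obj:
  assumes "f \<in> Hom C X Y"
  shows "X \<in> Obj C" "Y \<in> Obj C"
  using assms Dom_in Cod_in by (auto simp: Hom_def)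

text \<open>
  Since \<open>U \<circ> \<Gamma> = Id\<close> holds strictly, \<open>\<Gamma>\<close> sends \<open>X\<close> to an algebra carried by \<open>X\<close> itself and \<open>f\<close>
  to \<open>f\<close>. All that \<open>\<Gamma>\<close> contributes is the choice of the structure maps.
\<close>

lemma split_epi_forgetful_algebras_iff:
  assumes "monad C T \<mu> \<eta>"
  shows "split_epi_functor (EM_algebras C T \<mu> \<eta>) C forgetful \<longleftrightarrow>
    (\<exists>\<gamma>. natural_algebra_structure C T \<mu> \<eta> \<gamma>)" (is "split_epi_functor ?E C _ \<longleftrightarrow> _")
proof -
  interpret T: is_functor C C T using assms by (simp add: monad_def nat_trans_def)
  interpret E: category ?E using category_EM_algebras[OF assms] .
  show ?thesis
  proof
    assume "split_epi_functor ?E C forgetful"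
    then obtain \<Gamma> where \<Gamma>: "is_functor C ?E \<Gamma>"
      and eq: "functor_eq C (forgetful \<circ>\<^sub>F \<Gamma>) id_functor"
      unfolding split_epi_functor_def by blast
    interpret \<Gamma>: is_functor C ?E \<Gamma> by fact
    have ob: "fst (fobj \<Gamma> X) = X" if "X \<in> Obj C" for X
      using eq that by (simp add: functor_eq_def forgetful_def case_prod_unfold)
    have ar: "snd (snd (farr \<Gamma> f)) = f" if "f \<in> Hom C X Y" for f X Y
      using eq that by (simp add: functor_eq_def forgetful_def Hom_def case_prod_unfold)
    have "natural_algebra_structure C T \<mu> \<eta> (\<lambda>X. snd (fobj \<Gamma> X))"
      unfolding natural_algebra_structure_def
    proof (intro conjI ballI allI)
      fix X assume X: "X \<in> Obj C"
      show "(X, snd (fobj \<Gamma> X)) \<in> algebras C T \<mu> \<eta>"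
        using \<Gamma>.fobj_in[OF X] ob[OF X] by (metis EM_algebras_simps(1) prod.collapse)
    next
      fix X Y f assume f: "f \<in> Hom C X Y"
      show "f \<odot>\<^bsub>C\<^esub> snd (fobj \<Gamma> X) = snd (fobj \<Gamma> Y) \<odot>\<^bsub>C\<^esub> farr T f"
        using \<Gamma>.farr_in[OF f] ar[OF f] by (auto simp: Hom_EM_algebras)
    qed
    then show "\<exists>\<gamma>. natural_algebra_structure C T \<mu> \<eta> \<gamma>" by blast
  next
    assume "\<exists>\<gamma>. natural_algebra_structure C T \<mu> \<eta> \<gamma>"
    then obtain \<gamma> where alg: "\<And>X. X \<in> Obj C \<Longrightarrow> (X, \<gamma> X) \<in> algebras C T \<mu> \<eta>"
      and nat: "\<And>X Y f. f \<in> Hom C X Y \<Longrightarrow> f \<odot>\<^bsub>C\<^esub> \<gamma> X = \<gamma> Y \<odot>\<^bsub>C\<^esub> farr T f"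
      unfolding natural_algebra_structure_def by blast
    define \<Gamma> where "\<Gamma> = \<lparr>fobj = (\<lambda>X. (X, \<gamma> X)),
      farr = (\<lambda>f. ((Dom C f, \<gamma> (Dom C f)), (Cod C f, \<gamma> (Cod C f)), f))\<rparr>"
    have ob: "fobj \<Gamma> X = (X, \<gamma> X)" for X
      by (simp add: \<Gamma>_def)
    have ar: "farr \<Gamma> f = ((X, \<gamma> X), (Y, \<gamma> Y), f)" if "f \<in> Hom C X Y" for f X Y
      using that by (auto simp: \<Gamma>_def Hom_def)
    have "is_functor C ?E \<Gamma>"
    proof unfold_locales
      fix X assume X: "X \<in> Obj C"
      show "fobj \<Gamma> X \<in> Obj ?E"
        using alg[OF X] by (simp add: ob EM_algebras_simps)
      show "farr \<Gamma> (Ident C X) = Ident ?E (fobj \<Gamma> X)"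
        using ar[OF T.source.Ident_in[OF X]] by (simp add: ob EM_algebras_simps)
    next
      fix f X Y assume f: "f \<in> Hom C X Y"
      show "farr \<Gamma> f \<in> Hom ?E (fobj \<Gamma> X) (fobj \<Gamma> Y)"
        using f T.source.Hom_Obj[OF f] by (simp add: ob ar[OF f] Hom_EM_algebras alg nat)
    next
      fix f g X Y Z assume f: "f \<in> Hom C X Y" and g: "g \<in> Hom C Y Z"
      show "farr \<Gamma> (g \<odot>\<^bsub>C\<^esub> f) = farr \<Gamma> g \<odot>\<^bsub>?E\<^esub> farr \<Gamma> f"
        using ar[OF f] ar[OF g] ar[OF T.source.Comp_in[OF f g]] by (simp add: EM_algebras_simps)
    qed
    moreover have "functor_eq C (forgetful \<circ>\<^sub>F \<Gamma>) id_functor"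
      by (simp add: functor_eq_def forgetful_def \<Gamma>_def)
    ultimately show "split_epi_functor ?E C forgetful"
      unfolding split_epi_functor_def by blast
  qed
qed

lemma split_epi_forgetful_coalgebras_iff:
  assumes "comonad C G \<delta> \<epsilon>"
  shows "split_epi_functor (EM_coalgebras C G \<delta> \<epsilon>) C forgetful \<longleftrightarrow>
    (\<exists>\<gamma>. natural_coalgebra_structure C G \<delta> \<epsilon> \<gamma>)" (is "split_epi_functor ?E C _ \<longleftrightarrow> _")
proof -
  interpret G: is_functor C C G using assms by (simp add: comonad_def nat_trans_def)
  interpret E: category ?E using category_EM_coalgebras[OF assms] .
  show ?thesis
  proof
    assume "split_epi_functor ?E C forgetful"
    then obtain \<Gamma> where \<Gamma>: "is_functor C ?E \<Gamma>"
      and eq: "functor_eq C (forgetful \<circ>\<^sub>F \<Gamma>) id_functor"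
      unfolding split_epi_functor_def by blast
    interpret \<Gamma>: is_functor C ?E \<Gamma> by fact
    have ob: "fst (fobj \<Gamma> X) = X" if "X \<in> Obj C" for X
      using eq that by (simp add: functor_eq_def forgetful_def case_prod_unfold)
    have ar: "snd (snd (farr \<Gamma> f)) = f" if "f \<in> Hom C X Y" for f X Y
      using eq that by (simp add: functor_eq_def forgetful_def Hom_def case_prod_unfold)
    have "natural_coalgebra_structure C G \<delta> \<epsilon> (\<lambda>X. snd (fobj \<Gamma> X))"
      unfolding natural_coalgebra_structure_def
    proof (intro conjI ballI allI)
      fix X assume X: "X \<in> Obj C"
      show "(X, snd (fobj \<Gamma> X)) \<in> coalgebras C G \<delta> \<epsilon>"
        using \<Gamma>.fobj_in[OF X] ob[OF X] by (metis EM_coalgebras_simps(1) prod.collapse)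
    next
      fix X Y f assume f: "f \<in> Hom C X Y"
      show "snd (fobj \<Gamma> Y) \<odot>\<^bsub>C\<^esub> f = farr G f \<odot>\<^bsub>C\<^esub> snd (fobj \<Gamma> X)"
        using \<Gamma>.farr_in[OF f] ar[OF f] by (auto simp: Hom_EM_coalgebras)
    qed
    then show "\<exists>\<gamma>. natural_coalgebra_structure C G \<delta> \<epsilon> \<gamma>" by blast
  next
    assume "\<exists>\<gamma>. natural_coalgebra_structure C G \<delta> \<epsilon> \<gamma>"
    then obtain \<gamma> where coalg: "\<And>X. X \<in> Obj C \<Longrightarrow> (X, \<gamma> X) \<in> coalgebras C G \<delta> \<epsilon>"
      and nat: "\<And>X Y f. f \<in> Hom C X Y \<Longrightarrow> \<gamma> Y \<odot>\<^bsub>C\<^esub> f = farr G f \<odot>\<^bsub>C\<^esub> \<gamma> X"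
      unfolding natural_coalgebra_structure_def by blast
    define \<Gamma> where "\<Gamma> = \<lparr>fobj = (\<lambda>X. (X, \<gamma> X)),
      farr = (\<lambda>f. ((Dom C f, \<gamma> (Dom C f)), (Cod C f, \<gamma> (Cod C f)), f))\<rparr>"
    have ob: "fobj \<Gamma> X = (X, \<gamma> X)" for X
      by (simp add: \<Gamma>_def)
    have ar: "farr \<Gamma> f = ((X, \<gamma> X), (Y, \<gamma> Y), f)" if "f \<in> Hom C X Y" for f X Y
      using that by (auto simp: \<Gamma>_def Hom_def)
    have "is_functor C ?E \<Gamma>"
    proof unfold_locales
      fix X assume X: "X \<in> Obj C"
      show "fobj \<Gamma> X \<in> Obj ?E"
        using coalg[OF X] by (simp add: ob EM_coalgebras_simps)
      show "farr \<Gamma> (Ident C X) = Ident ?E (fobj \<Gamma> X)"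
        using ar[OF G.source.Ident_in[OF X]] by (simp add: ob EM_coalgebras_simps)
    next
      fix f X Y assume f: "f \<in> Hom C X Y"
      show "farr \<Gamma> f \<in> Hom ?E (fobj \<Gamma> X) (fobj \<Gamma> Y)"
        using f G.source.Hom_Obj[OF f] by (simp add: ob ar[OF f] Hom_EM_coalgebras coalg nat)
    next
      fix f g X Y Z assume f: "f \<in> Hom C X Y" and g: "g \<in> Hom C Y Z"
      show "farr \<Gamma> (g \<odot>\<^bsub>C\<^esub> f) = farr \<Gamma> g \<odot>\<^bsub>?E\<^esub> farr \<Gamma> f"
        using ar[OF f] ar[OF g] ar[OF G.source.Comp_in[OF f g]] by (simp add: EM_coalgebras_simps)
    qed
    moreover have "functor_eq C (forgetful \<circ>\<^sub>F \<Gamma>) id_functor"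
      by (simp add: functor_eq_def forgetful_def \<Gamma>_def)
    ultimately show "split_epi_functor ?E C forgetful"
      unfolding split_epi_functor_def by blast
  qed
qed

section \<open>Heavy separability of a left adjoint\<close>

text \<open>
  A multiplicative \<open>P\<close> with \<open>P(Ff) = f\<close> is natural, since
  \<open>P(Fv \<circ> h \<circ> Fu) = P(Fv) \<circ> P(h) \<circ> P(Fu) = v \<circ> P(h) \<circ> u\<close>. In this form heavy separability is
  visibly self-dual.
\<close>

lemma (in is_functor) h_separable_iff_multiplicative_splitting:
  "h_separable C D F \<longleftrightarrow> (\<exists>P.
     (\<forall>X\<in>Obj C. \<forall>Y\<in>Obj C. \<forall>h\<in>Hom D (fobj F X) (fobj F Y). P X Y h \<in> Hom C X Y) \<and>
     (\<forall>X\<in>Obj C. \<forall>Y\<in>Obj C. \<forall>f\<in>Hom C X Y. P X Y (farr F f) = f) \<and>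
     (\<forall>X\<in>Obj C. \<forall>Y\<in>Obj C. \<forall>Z\<in>Obj C.
        \<forall>g\<in>Hom D (fobj F X) (fobj F Y). \<forall>f\<in>Hom D (fobj F Y) (fobj F Z).
          P X Z (f \<odot>\<^bsub>D\<^esub> g) = P Y Z f \<odot>\<^bsub>C\<^esub> P X Y g))"
  (is "_ \<longleftrightarrow> (\<exists>P. ?maps P \<and> ?split P \<and> ?mult P)")
proof
  assume "h_separable C D F"
  then show "\<exists>P. ?maps P \<and> ?split P \<and> ?mult P"
    unfolding h_separable_def by blast
next
  assume "\<exists>P. ?maps P \<and> ?split P \<and> ?mult P"
  then obtain P where P: "?maps P" "?split P" "?mult P" by blast
  have "P X' Y' (farr F v \<odot>\<^bsub>D\<^esub> h \<odot>\<^bsub>D\<^esub> farr F u) = v \<odot>\<^bsub>C\<^esub> P X Y h \<odot>\<^bsub>C\<^esub> u"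
    if "X \<in> Obj C" "Y \<in> Obj C" "X' \<in> Obj C" "Y' \<in> Obj C"
      and u: "u \<in> Hom C X' X" and v: "v \<in> Hom C Y Y'" and h: "h \<in> Hom D (fobj F X) (fobj F Y)"
    for X Y X' Y' u v h
  proof -
    have "farr F v \<odot>\<^bsub>D\<^esub> h \<in> Hom D (fobj F X) (fobj F Y')"
      using target.Comp_in[OF h farr_in[OF v]] .
    then show ?thesis using P(2,3) that farr_in[OF u] farr_in[OF v] by simp
  qed
  then show "h_separable C D F"
    unfolding h_separable_def using P by (intro exI[of _ P]) blast
qed

context adjunction
begin

lemma counit_in: "Y \<in> Obj A \<Longrightarrow> \<epsilon> Y \<in> Hom A (fobj L (fobj R Y)) Y"
  using counit.component_in by simp

lemma unit_in: "X \<in> Obj B \<Longrightarrow> \<eta> X \<in> Hom B X (fobj R (fobj L X))"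
  using unit.component_in by simp

lemma counit_natural: "f \<in> Hom A X Y \<Longrightarrow> \<epsilon> Y \<odot>\<^bsub>A\<^esub> farr L (farr R f) = f \<odot>\<^bsub>A\<^esub> \<epsilon> X"
  using counit.naturality by simp

text \<open>
  Take \<open>\<gamma>\<^sub>X = P(\<epsilon>\<^bsub>LX\<^esub>)\<close>. For \<open>f\<close> into \<open>RLX\<close>, multiplicativity gives \<open>\<gamma>\<^sub>X \<circ> f = P(\<epsilon>\<^bsub>LX\<^esub> \<circ> Lf)\<close>,
  which is \<open>P\<close> of the adjunct of \<open>f\<close>. This turns the unit law into the triangle identity, and
  naturality into naturality of \<open>\<epsilon>\<close>. Naturality of \<open>\<epsilon>\<close> at \<open>\<epsilon>\<^bsub>LX\<^esub>\<close> itself gives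
  \<open>\<gamma>\<^sub>X \<circ> R\<epsilon>\<^bsub>LX\<^esub> = \<gamma>\<^sub>X \<circ> \<gamma>\<^bsub>RLX\<^esub>\<close>, and the associativity law follows by naturality of \<open>\<gamma>\<close> at \<open>\<gamma>\<^sub>X\<close>.
\<close>

lemma natural_algebra_structure_if_h_separable:
  assumes "h_separable B A L"
  shows "\<exists>\<gamma>. natural_algebra_structure B (R \<circ>\<^sub>F L) (\<lambda>X. farr R (\<epsilon> (fobj L X))) \<eta> \<gamma>"
proof -
  obtain P
    where P: "\<forall>X\<in>Obj B. \<forall>Y\<in>Obj B. \<forall>h\<in>Hom A (fobj L X) (fobj L Y). P X Y h \<in> Hom B X Y"
      "\<forall>X\<in>Obj B. \<forall>Y\<in>Obj B. \<forall>f\<in>Hom B X Y. P X Y (farr L f) = f"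
      "\<forall>X\<in>Obj B. \<forall>Y\<in>Obj B. \<forall>Z\<in>Obj B.
        \<forall>g\<in>Hom A (fobj L X) (fobj L Y). \<forall>f\<in>Hom A (fobj L Y) (fobj L Z).
          P X Z (f \<odot>\<^bsub>A\<^esub> g) = P Y Z f \<odot>\<^bsub>B\<^esub> P X Y g"
    using assms unfolding L.h_separable_iff_multiplicative_splitting by blast
  note P_in = P(1)[rule_format] and P_L = P(2)[rule_format] and P_mult = P(3)[rule_format]
  define \<gamma> where "\<gamma> X = P (fobj R (fobj L X)) X (\<epsilon> (fobj L X))" for X
  have RL: "fobj R (fobj L X) \<in> Obj B" if "X \<in> Obj B" for X
    using that by (simp add: L.fobj_in R.fobj_in)
  have e: "\<epsilon> (fobj L X) \<in> Hom A (fobj L (fobj R (fobj L X))) (fobj L X)" if "X \<in> Obj B" for X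
    using counit_in[OF L.fobj_in[OF that]] .
  have \<gamma>_in: "\<gamma> X \<in> Hom B (fobj R (fobj L X)) X" if "X \<in> Obj B" for X
    unfolding \<gamma>_def using P_in[OF RL[OF that] that e[OF that]] .
  have \<gamma>_comp: "\<gamma> X \<odot>\<^bsub>B\<^esub> f = P W X (\<epsilon> (fobj L X) \<odot>\<^bsub>A\<^esub> farr L f)"
    if X: "X \<in> Obj B" and f: "f \<in> Hom B W (fobj R (fobj L X))" for X W f
    using P_mult[OF L.source.Hom_Obj(1)[OF f] RL[OF X] X L.farr_in[OF f] e[OF X]]
      P_L[OF L.source.Hom_Obj(1)[OF f] RL[OF X] f] by (simp add: \<gamma>_def)
  have nat: "f \<odot>\<^bsub>B\<^esub> \<gamma> X = \<gamma> Y \<odot>\<^bsub>B\<^esub> farr R (farr L f)" if f: "f \<in> Hom B X Y" for f X Y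
  proof -
    note X = L.source.Hom_Obj(1)[OF f] and Y = L.source.Hom_Obj(2)[OF f]
    have "\<gamma> Y \<odot>\<^bsub>B\<^esub> farr R (farr L f) = P (fobj R (fobj L X)) Y (farr L f \<odot>\<^bsub>A\<^esub> \<epsilon> (fobj L X))"
      using \<gamma>_comp[OF Y R.farr_in[OF L.farr_in[OF f]]] counit_natural[OF L.farr_in[OF f]] by simp
    also have "\<dots> = f \<odot>\<^bsub>B\<^esub> \<gamma> X"
      using P_mult[OF RL[OF X] X Y e[OF X] L.farr_in[OF f]] P_L[OF X Y f] by (simp add: \<gamma>_def)
    finally show ?thesis by simp
  qed
  have \<gamma>_unit: "\<gamma> X \<odot>\<^bsub>B\<^esub> \<eta> X = Ident B X" if X: "X \<in> Obj B" for X
    using \<gamma>_comp[OF X unit_in[OF X]] triangle_L[OF X]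
      P_L[OF X X L.source.Ident_in[OF X]] L.farr_Ident[OF X] by simp
  have \<gamma>_mult: "\<gamma> X \<odot>\<^bsub>B\<^esub> farr R (\<epsilon> (fobj L X)) = \<gamma> X \<odot>\<^bsub>B\<^esub> farr R (farr L (\<gamma> X))"
    if X: "X \<in> Obj B" for X
  proof -
    have "\<gamma> X \<odot>\<^bsub>B\<^esub> farr R (\<epsilon> (fobj L X)) = P (fobj R (fobj L (fobj R (fobj L X)))) X
        (\<epsilon> (fobj L X) \<odot>\<^bsub>A\<^esub> \<epsilon> (fobj L (fobj R (fobj L X))))"
      using \<gamma>_comp[OF X R.farr_in[OF e[OF X]]] counit_natural[OF e[OF X]] by simp
    also have "\<dots> = \<gamma> X \<odot>\<^bsub>B\<^esub> \<gamma> (fobj R (fobj L X))"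
      using P_mult[OF RL[OF RL[OF X]] RL[OF X] X e[OF RL[OF X]] e[OF X]] by (simp add: \<gamma>_def)
    also have "\<dots> = \<gamma> X \<odot>\<^bsub>B\<^esub> farr R (farr L (\<gamma> X))"
      using nat[OF \<gamma>_in[OF X]] .
    finally show ?thesis .
  qed
  have "natural_algebra_structure B (R \<circ>\<^sub>F L) (\<lambda>X. farr R (\<epsilon> (fobj L X))) \<eta> \<gamma>"
    by (simp add: natural_algebra_structure_def algebras_def \<gamma>_in \<gamma>_unit \<gamma>_mult nat)
  then show ?thesis by blast
qed

text \<open>
  \<open>P(h) = \<gamma>\<^sub>Y \<circ> Rh \<circ> \<eta>\<^sub>X\<close> is the adjunct \<open>X \<rightarrow> RLY\<close> of \<open>h\<close> pushed down to \<open>Y\<close>. Naturality of \<open>\<gamma>\<close> and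
  the unit law give \<open>P(Lf) = f\<close>; naturality and associativity of the algebra structures give
  multiplicativity.
\<close>

lemma h_separable_if_natural_algebra_structure:
  assumes "natural_algebra_structure B (R \<circ>\<^sub>F L) (\<lambda>X. farr R (\<epsilon> (fobj L X))) \<eta> \<gamma>"
  shows "h_separable B A L"
proof -
  have \<gamma>_in: "\<gamma> X \<in> Hom B (fobj R (fobj L X)) X"
    and \<gamma>_unit: "\<gamma> X \<odot>\<^bsub>B\<^esub> \<eta> X = Ident B X"
    and \<gamma>_mult: "\<gamma> X \<odot>\<^bsub>B\<^esub> farr R (\<epsilon> (fobj L X)) = \<gamma> X \<odot>\<^bsub>B\<^esub> farr R (farr L (\<gamma> X))"
    if "X \<in> Obj B" for X
    using assms that by (auto simp: natural_algebra_structure_def algebras_def)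
  have nat: "f \<odot>\<^bsub>B\<^esub> \<gamma> X = \<gamma> Y \<odot>\<^bsub>B\<^esub> farr R (farr L f)" if "f \<in> Hom B X Y" for f X Y
    using assms that by (simp add: natural_algebra_structure_def)
  define P where "P X Y h = \<gamma> Y \<odot>\<^bsub>B\<^esub> (farr R h \<odot>\<^bsub>B\<^esub> \<eta> X)" for X Y h
  have Rh: "farr R h \<odot>\<^bsub>B\<^esub> \<eta> X \<in> Hom B X (fobj R (fobj L Y))"
    if "X \<in> Obj B" "h \<in> Hom A (fobj L X) (fobj L Y)" for X Y h
    using L.source.Comp_in[OF unit_in[OF that(1)] R.farr_in[OF that(2)]] .
  have P_in: "P X Y h \<in> Hom B X Y"
    if "X \<in> Obj B" "Y \<in> Obj B" "h \<in> Hom A (fobj L X) (fobj L Y)" for X Y h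
    unfolding P_def using L.source.Comp_in[OF Rh[OF that(1,3)] \<gamma>_in[OF that(2)]] .
  have P_L: "P X Y (farr L f) = f" if f: "f \<in> Hom B X Y" for X Y f
  proof -
    note X = L.source.Hom_Obj(1)[OF f] and Y = L.source.Hom_Obj(2)[OF f]
    have "P X Y (farr L f) = f \<odot>\<^bsub>B\<^esub> \<gamma> X \<odot>\<^bsub>B\<^esub> \<eta> X"
      unfolding P_def nat[OF f]
      using L.source.Comp_assoc[OF unit_in[OF X] R.farr_in[OF L.farr_in[OF f]] \<gamma>_in[OF Y]] by simp
    also have "\<dots> = f"
      using L.source.Comp_assoc[OF unit_in[OF X] \<gamma>_in[OF X] f] \<gamma>_unit[OF X]
        L.source.Comp_Ident[OF f] by simp
    finally show ?thesis .
  qed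
  \<comment> \<open>Both sides are algebra morphisms from the free algebra on \<open>Y\<close> to \<open>(Z, \<gamma> Z)\<close> that extend
    \<open>P Y Z f\<close>; the computation below expresses both as \<open>\<gamma> Z \<circ> \<mu> \<circ> RL(Rf \<circ> \<eta>)\<close>.\<close>
  have absorb: "P Y Z f \<odot>\<^bsub>B\<^esub> \<gamma> Y = \<gamma> Z \<odot>\<^bsub>B\<^esub> farr R f"
    if Y: "Y \<in> Obj B" and Z: "Z \<in> Obj B" and f: "f \<in> Hom A (fobj L Y) (fobj L Z)" for Y Z f
  proof -
    let ?k = "farr R f \<odot>\<^bsub>B\<^esub> \<eta> Y"
    note k = Rh[OF Y f]
    have e: "\<epsilon> (fobj L X) \<in> Hom A (fobj L (fobj R (fobj L X))) (fobj L X)" if "X \<in> Obj B" for X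
      using counit_in[OF L.fobj_in[OF that]] .
    note RLk = R.farr_in[OF L.farr_in[OF k]]
    have "\<epsilon> (fobj L Z) \<odot>\<^bsub>A\<^esub> farr L ?k = \<epsilon> (fobj L Z) \<odot>\<^bsub>A\<^esub> farr L (farr R f) \<odot>\<^bsub>A\<^esub> farr L (\<eta> Y)"
      using L.farr_Comp[OF unit_in[OF Y] R.farr_in[OF f]]
        L.target.Comp_assoc[OF L.farr_in[OF unit_in[OF Y]] L.farr_in[OF R.farr_in[OF f]] e[OF Z]]
      by simp
    also have "\<dots> = f \<odot>\<^bsub>A\<^esub> (\<epsilon> (fobj L Y) \<odot>\<^bsub>A\<^esub> farr L (\<eta> Y))"
      using counit_natural[OF f] L.target.Comp_assoc[OF L.farr_in[OF unit_in[OF Y]] e[OF Y] f]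
      by simp
    also have "\<dots> = f"
      using triangle_L[OF Y] L.target.Comp_Ident[OF f] by simp
    finally have adjunct: "\<epsilon> (fobj L Z) \<odot>\<^bsub>A\<^esub> farr L ?k = f" .
    have "P Y Z f \<odot>\<^bsub>B\<^esub> \<gamma> Y = \<gamma> Z \<odot>\<^bsub>B\<^esub> farr R (farr L (P Y Z f))"
      using nat[OF P_in[OF Y Z f]] .
    also have "\<dots> = \<gamma> Z \<odot>\<^bsub>B\<^esub> farr R (farr L (\<gamma> Z)) \<odot>\<^bsub>B\<^esub> farr R (farr L ?k)"
      unfolding P_def
      using L.farr_Comp[OF k \<gamma>_in[OF Z]] R.farr_Comp[OF L.farr_in[OF k] L.farr_in[OF \<gamma>_in[OF Z]]]
        L.source.Comp_assoc[OF RLk R.farr_in[OF L.farr_in[OF \<gamma>_in[OF Z]]] \<gamma>_in[OF Z]] by simp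
    also have "\<dots> = \<gamma> Z \<odot>\<^bsub>B\<^esub> farr R (\<epsilon> (fobj L Z)) \<odot>\<^bsub>B\<^esub> farr R (farr L ?k)"
      using \<gamma>_mult[OF Z] by simp
    also have "\<dots> = \<gamma> Z \<odot>\<^bsub>B\<^esub> farr R (\<epsilon> (fobj L Z) \<odot>\<^bsub>A\<^esub> farr L ?k)"
      using L.source.Comp_assoc[OF RLk R.farr_in[OF e[OF Z]] \<gamma>_in[OF Z]]
        R.farr_Comp[OF L.farr_in[OF k] e[OF Z]] by simp
    also have "\<dots> = \<gamma> Z \<odot>\<^bsub>B\<^esub> farr R f"
      by (simp only: adjunct)
    finally show ?thesis .
  qed
  have P_mult: "P X Z (f \<odot>\<^bsub>A\<^esub> g) = P Y Z f \<odot>\<^bsub>B\<^esub> P X Y g"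
    if X: "X \<in> Obj B" and Y: "Y \<in> Obj B" and Z: "Z \<in> Obj B"
      and g: "g \<in> Hom A (fobj L X) (fobj L Y)" and f: "f \<in> Hom A (fobj L Y) (fobj L Z)"
    for X Y Z f g
  proof -
    have "P Y Z f \<odot>\<^bsub>B\<^esub> P X Y g = P Y Z f \<odot>\<^bsub>B\<^esub> \<gamma> Y \<odot>\<^bsub>B\<^esub> (farr R g \<odot>\<^bsub>B\<^esub> \<eta> X)"
      using L.source.Comp_assoc[OF Rh[OF X g] \<gamma>_in[OF Y] P_in[OF Y Z f]] by (simp add: P_def)
    also have "\<dots> = \<gamma> Z \<odot>\<^bsub>B\<^esub> farr R f \<odot>\<^bsub>B\<^esub> (farr R g \<odot>\<^bsub>B\<^esub> \<eta> X)"
      using absorb[OF Y Z f] by simp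
    also have "\<dots> = P X Z (f \<odot>\<^bsub>A\<^esub> g)"
      using L.source.Comp_assoc[OF Rh[OF X g] R.farr_in[OF f] \<gamma>_in[OF Z]]
        L.source.Comp_assoc[OF unit_in[OF X] R.farr_in[OF g] R.farr_in[OF f]] R.farr_Comp[OF g f]
      by (simp add: P_def)
    finally show ?thesis by simp
  qed
  show ?thesis
    unfolding L.h_separable_iff_multiplicative_splitting
    using P_in P_L P_mult by (intro exI[of _ P]) blast
qed

lemma h_separable_left_adjoint_iff:
  "h_separable B A L \<longleftrightarrow>
    (\<exists>\<gamma>. natural_algebra_structure B (R \<circ>\<^sub>F L) (\<lambda>X. farr R (\<epsilon> (fobj L X))) \<eta> \<gamma>)"
  using natural_algebra_structure_if_h_separable h_separable_if_natural_algebra_structure by blast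

end

section \<open>Duality\<close>

text \<open>
  Objects and arrows of the opposite category are those of \<open>C\<close>, so the same records serve as
  functors and the same families as natural transformations between opposite categories.
\<close>

definition op_cat :: "('o, 'm) cat \<Rightarrow> ('o, 'm) cat" where
  "op_cat C = \<lparr>Obj = Obj C, Arr = Arr C, Dom = Cod C, Cod = Dom C, Ident = Ident C,
    Comp = (\<lambda>g f. f \<odot>\<^bsub>C\<^esub> g)\<rparr>"

lemma op_cat_simps [simp]:
  "Obj (op_cat C) = Obj C" "Arr (op_cat C) = Arr C" "Dom (op_cat C) = Cod C"
  "Cod (op_cat C) = Dom C" "Ident (op_cat C) = Ident C" "g \<odot>\<^bsub>op_cat C\<^esub> f = f \<odot>\<^bsub>C\<^esub> g"
  by (simp_all add: op_cat_def)

lemma op_cat_op_cat [simp]: "op_cat (op_cat C) = C"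
  by (simp add: op_cat_def)

lemma Hom_op_cat [simp]: "Hom (op_cat C) X Y = Hom C Y X"
  by (auto simp: Hom_def)

lemma category_op:
  assumes "category C"
  shows "category (op_cat C)"
proof -
  interpret category C by fact
  show ?thesis
    by unfold_locales
      (simp_all add: Dom_in Cod_in Ident_in Comp_in Comp_Ident Ident_Comp Comp_assoc)
qed

lemma is_functor_op:
  assumes "is_functor C D F"
  shows "is_functor (op_cat C) (op_cat D) F"
proof -
  interpret is_functor C D F by fact
  show ?thesis
    unfolding is_functor_def is_functor_axioms_def
    using category_op[OF source.category_axioms] category_op[OF target.category_axioms]
    by (simp add: fobj_in farr_in farr_Ident farr_Comp)
qed

lemma nat_trans_op:
  assumes "nat_trans C D F G \<tau>"
  shows "nat_trans (op_cat C) (op_cat D) G F \<tau>"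
proof -
  interpret nat_trans C D F G \<tau> by fact
  show ?thesis
    unfolding nat_trans_def nat_trans_axioms_def
    using is_functor_op[OF F.is_functor_axioms] is_functor_op[OF G.is_functor_axioms]
    by (simp add: component_in naturality)
qed

lemma adjunction_op:
  assumes "adjunction B A L R \<eta> \<epsilon>"
  shows "adjunction (op_cat A) (op_cat B) R L \<epsilon> \<eta>"
proof -
  interpret adjunction B A L R \<eta> \<epsilon> by fact
  show ?thesis
    unfolding adjunction_def adjunction_axioms_def
    using is_functor_op[OF L.is_functor_axioms] is_functor_op[OF R.is_functor_axioms]
      nat_trans_op[OF unit.nat_trans_axioms] nat_trans_op[OF counit.nat_trans_axioms]
    by (simp add: triangle_L triangle_R)
qed

lemma natural_algebra_structure_op:
  "natural_algebra_structure (op_cat C) G \<delta> \<epsilon> \<gamma> \<longleftrightarrow> natural_coalgebra_structure C G \<delta> \<epsilon> \<gamma>"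
  by (auto simp: natural_algebra_structure_def natural_coalgebra_structure_def
      algebras_def coalgebras_def)

lemma h_separable_op_if:
  assumes F: "is_functor C D F" and sep: "h_separable C D F"
  shows "h_separable (op_cat C) (op_cat D) F"
proof -
  obtain P
    where "\<forall>X\<in>Obj C. \<forall>Y\<in>Obj C. \<forall>h\<in>Hom D (fobj F X) (fobj F Y). P X Y h \<in> Hom C X Y"
      and "\<forall>X\<in>Obj C. \<forall>Y\<in>Obj C. \<forall>f\<in>Hom C X Y. P X Y (farr F f) = f"
      and "\<forall>X\<in>Obj C. \<forall>Y\<in>Obj C. \<forall>Z\<in>Obj C.
        \<forall>g\<in>Hom D (fobj F X) (fobj F Y). \<forall>f\<in>Hom D (fobj F Y) (fobj F Z).
          P X Z (f \<odot>\<^bsub>D\<^esub> g) = P Y Z f \<odot>\<^bsub>C\<^esub> P X Y g"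
    using sep unfolding is_functor.h_separable_iff_multiplicative_splitting[OF F] by blast
  then show ?thesis
    unfolding is_functor.h_separable_iff_multiplicative_splitting[OF is_functor_op[OF F]]
    by (intro exI[of _ "\<lambda>X Y. P Y X"]) simp
qed

lemma h_separable_op_iff:
  assumes "is_functor C D F"
  shows "h_separable (op_cat C) (op_cat D) F \<longleftrightarrow> h_separable C D F"
  using h_separable_op_if[OF assms] h_separable_op_if[OF is_functor_op[OF assms]] by auto

lemma (in adjunction) h_separable_right_adjoint_iff:
  "h_separable A B R \<longleftrightarrow>
    (\<exists>\<gamma>. natural_coalgebra_structure A (L \<circ>\<^sub>F R) (\<lambda>Y. farr L (\<eta> (fobj R Y))) \<epsilon> \<gamma>)"
  using adjunction.h_separable_left_adjoint_iff[OF adjunction_op[OF adjunction_axioms]]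
  by (simp add: h_separable_op_iff[OF R.is_functor_axioms] natural_algebra_structure_op)

theorem proposition2p3:
  fixes B :: "('ob, 'mb) cat" and A :: "('oa, 'ma) cat"
    and L :: "('ob, 'mb, 'oa, 'ma) fctr" and R :: "('oa, 'ma, 'ob, 'mb) fctr"
    and \<eta> :: "'ob \<Rightarrow> 'mb" and \<epsilon> :: "'oa \<Rightarrow> 'ma"
  assumes "adjunction B A L R \<eta> \<epsilon>"
  shows "(h_separable B A L \<longleftrightarrow>
            split_epi_functor
              (EM_algebras B (R \<circ>\<^sub>F L) (\<lambda>X. farr R (\<epsilon> (fobj L X))) \<eta>) B forgetful) \<and>
         (h_separable A B R \<longleftrightarrow>
            split_epi_functor
              (EM_coalgebras A (L \<circ>\<^sub>F R) (\<lambda>Y. farr L (\<eta> (fobj R Y))) \<epsilon>) A forgetful)"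
proof -
  interpret adjunction B A L R \<eta> \<epsilon> by fact
  show ?thesis
    by (simp only: h_separable_left_adjoint_iff h_separable_right_adjoint_iff
        split_epi_forgetful_algebras_iff[OF monad_RL]
        split_epi_forgetful_coalgebras_iff[OF comonad_LR])
qed

end
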